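(* For every completely positive trace-preserving (CPTP) linear map $\Phi:\Omega_2\to\Omega_2$ and all $\rho^A,\rho^B\in\Omega_2$, $$T^Q\big(\Phi(\rho^A),\Phi(\rho^B)\big)\le T^Q(\rho^A,\rho^B).$$ Equivalently, $W(\Phi(\rho^A),\Phi(\rho^B))\le W(\rho^A,\rho^B)$ with $W=\sqrt{T^Q}$.
   Context: $\Omega_N=\{\rho\in\mathbb{C}^{N\times N}:\rho=\rho^*,\ \rho\ge0,\ \operatorname{Tr}\rho=1\}$ is the set of density matrices of order $N$. Let $S$ be the swap operator on $\mathbb{C}^N\otimes\mathbb{C}^N$, $S(|x\rangle|y\rangle)=|y\rangle|x\rangle$, and let $C^Q=\tfrac12(\mathbb{1}-S)$, the projector onto the antisymmetric subspace. For $\rho^A,\rho^B\in\Omega_N$, let $\Gamma^Q(\rho^A,\rho^B)$ be the set of density matrices $\rho^{AB}$ on $\mathbb{C}^N\otimes\mathbb{C}^N$ with partial traces $\operatorname{Tr}_B\rho^{AB}=\rho^A$ and $\operatorname{Tr}_A\rho^{AB}=\rho^B$. The optimal quantum transport cost is $$T^Q(\rho^A,\rho^B)=\min_{\rho^{AB}\in\Gamma^Q(\rho^A,\rho^B)}\operatorname{Tr}(C^Q\rho^{AB}).$$ *)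

theory Defs
  imports "Jordan_Normal_Form.Schur_Decomposition"
begin

(* Matrices are Jordan_Normal_Form complex matrices. The tensor product
   C^N \<otimes> C^M is identified with C^(N*M) via |i>|j> \<mapsto> e_(i*M+j). *)

definition mtrace :: "complex mat \<Rightarrow> complex" where
  "mtrace A = (\<Sum>i<dim_row A. A $$ (i,i))"

definition psd :: "nat \<Rightarrow> complex mat \<Rightarrow> bool" where
  "psd n A \<longleftrightarrow> A \<in> carrier_mat n n \<and> mat_adjoint A = A \<and>
     (\<forall>v \<in> carrier_vec n. 0 \<le> Re (conjugate v \<bullet> (A *\<^sub>v v)))"

definition density :: "nat \<Rightarrow> complex mat \<Rightarrow> bool" where
  "density n \<rho> \<longleftrightarrow> psd n \<rho> \<and> mtrace \<rho> = 1"

definition ptrace_B :: "nat \<Rightarrow> complex mat \<Rightarrow> complex mat" where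
  "ptrace_B N R = mat N N (\<lambda>(i,k). \<Sum>j<N. R $$ (i*N+j, k*N+j))"

definition ptrace_A :: "nat \<Rightarrow> complex mat \<Rightarrow> complex mat" where
  "ptrace_A N R = mat N N (\<lambda>(j,l). \<Sum>i<N. R $$ (i*N+j, i*N+l))"

definition swap_op :: "nat \<Rightarrow> complex mat" where
  "swap_op N = mat (N*N) (N*N) (\<lambda>(r,c). if r = (c mod N) * N + c div N then 1 else 0)"

definition cost_Q :: "nat \<Rightarrow> complex mat" where
  "cost_Q N = (1/2 :: complex) \<cdot>\<^sub>m (1\<^sub>m (N*N) - swap_op N)"

definition couplings :: "nat \<Rightarrow> complex mat \<Rightarrow> complex mat \<Rightarrow> complex mat set" where
  "couplings N \<rho>A \<rho>B = {R. density (N*N) R \<and> ptrace_B N R = \<rho>A \<and> ptrace_A N R = \<rho>B}"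

(* optimal quantum transport cost (the minimum; the infimum is attained) *)
definition T_Q :: "nat \<Rightarrow> complex mat \<Rightarrow> complex mat \<Rightarrow> real" where
  "T_Q N \<rho>A \<rho>B = Inf ((\<lambda>R. Re (mtrace (cost_Q N * R))) ` couplings N \<rho>A \<rho>B)"

(* (id_k \<otimes> \<Phi>) applied to a (k*n)x(k*n) matrix, viewed as k x k blocks of n x n matrices *)
definition id_tensor :: "nat \<Rightarrow> nat \<Rightarrow> (complex mat \<Rightarrow> complex mat) \<Rightarrow> complex mat \<Rightarrow> complex mat" where
  "id_tensor k n \<Phi> X = mat (k*n) (k*n) (\<lambda>(r,c).
      \<Phi> (mat n n (\<lambda>(i,j). X $$ ((r div n)*n + i, (c div n)*n + j))) $$ (r mod n, c mod n))"

definition linear_map_mat :: "nat \<Rightarrow> (complex mat \<Rightarrow> complex mat) \<Rightarrow> bool" where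
  "linear_map_mat n \<Phi> \<longleftrightarrow>
     (\<forall>A \<in> carrier_mat n n. \<Phi> A \<in> carrier_mat n n) \<and>
     (\<forall>A \<in> carrier_mat n n. \<forall>B \<in> carrier_mat n n. \<Phi> (A + B) = \<Phi> A + \<Phi> B) \<and>
     (\<forall>A \<in> carrier_mat n n. \<forall>c. \<Phi> (c \<cdot>\<^sub>m A) = c \<cdot>\<^sub>m \<Phi> A)"

definition completely_positive :: "nat \<Rightarrow> (complex mat \<Rightarrow> complex mat) \<Rightarrow> bool" where
  "completely_positive n \<Phi> \<longleftrightarrow>
     (\<forall>k. \<forall>X. psd (k*n) X \<longrightarrow> psd (k*n) (id_tensor k n \<Phi> X))"

definition trace_preserving :: "nat \<Rightarrow> (complex mat \<Rightarrow> complex mat) \<Rightarrow> bool" where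
  "trace_preserving n \<Phi> \<longleftrightarrow> (\<forall>A \<in> carrier_mat n n. mtrace (\<Phi> A) = mtrace A)"

definition CPTP :: "nat \<Rightarrow> (complex mat \<Rightarrow> complex mat) \<Rightarrow> bool" where
  "CPTP n \<Phi> \<longleftrightarrow> linear_map_mat n \<Phi> \<and> completely_positive n \<Phi> \<and> trace_preserving n \<Phi>"

end

theory Submission
  imports "HOL-Analysis.Topology_Euclidean_Space" Defs
begin

text \<open>
  For qubits the transport cost equals the maximum over unit vectors \<open>u\<close> of
  \<open>(sqrt \<langle>u|A|u\<rangle> - sqrt \<langle>u|B|u\<rangle>)\<^sup>2 / 2\<close>.
  That no coupling is cheaper is the Cauchy--Schwarz inequality, because the singlet has the
  same form in the basis consisting of \<open>u\<close> and its orthogonal vector \<open>w\<close>.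
  Conversely, let \<open>u\<close> be a maximiser, \<open>x = \<langle>u|A|u\<rangle>\<close> and \<open>y = \<langle>u|B|u\<rangle>\<close>. Stationarity gives a
  number \<open>\<kappa>\<close> with \<open>\<langle>u|A|w\<rangle> = sqrt x \<kappa>\<close> and \<open>\<langle>u|B|w\<rangle> = sqrt y \<kappa>\<close>, and comparing \<open>u\<close> with the vector
  whose Bloch vector is reflected along the difference of the Bloch vectors of \<open>A\<close> and \<open>B\<close> gives
  \<open>x + y + |\<kappa>|\<^sup>2 \<le> 1\<close>. These are exactly the conditions under which
  \<open>|\<xi>\<rangle>\<langle>\<xi>| + (1 - x - y - |\<kappa>|\<^sup>2) |ww\<rangle>\<langle>ww|\<close> with
  \<open>\<xi> = sqrt x |uw\<rangle> + sqrt y |wu\<rangle> + cnj \<kappa> |ww\<rangle>\<close> is a coupling, and its cost is \<open>(sqrt x - sqrt y)\<^sup>2 / 2\<close>.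

  For monotonicity, diagonalising the effect obtained by pulling \<open>|u\<rangle>\<langle>u|\<close> back along \<open>\<Phi>\<close> yields
  \<open>\<langle>u|\<Phi> X|u\<rangle> = l + m \<langle>s|X|s\<rangle>\<close> on density matrices with \<open>0 \<le> l\<close>, \<open>0 \<le> m \<le> 1\<close> and a unit
  vector \<open>s\<close>, and such affine maps do not increase differences of square roots.
\<close>

section \<open>Hermitian forms in two variables\<close>

text \<open>The value \<open>\<langle>z|A|z\<rangle>\<close> at \<open>z = (u, v)\<close> for the
  Hermitian matrix with diagonal \<open>a\<close>, \<open>b\<close> and upper right entry
  \<open>c\<close>, kept real so that its square roots can be compared.\<close>

definition qform :: "real \<Rightarrow> real \<Rightarrow> complex \<Rightarrow> complex \<Rightarrow> complex \<Rightarrow> real" where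
  "qform a b c u v = a * (cmod u)\<^sup>2 + b * (cmod v)\<^sup>2 + 2 * Re (cnj u * v * c)"

text \<open>The matrix element between \<open>(u, v)\<close> and the orthogonal vector \<open>(- cnj v, cnj u)\<close>.\<close>

definition offdiag :: "real \<Rightarrow> real \<Rightarrow> complex \<Rightarrow> complex \<Rightarrow> complex \<Rightarrow> complex" where
  "offdiag a b c u v = cnj u * cnj u * c - cnj v * cnj v * cnj c + of_real (b - a) * cnj u * cnj v"

text \<open>As a polynomial in the variables and their conjugates the form is open to ring
  normalisation.\<close>

lemma of_real_qform:
  "complex_of_real (qform a b c u v)
     = a * (u * cnj u) + b * (v * cnj v) + cnj u * v * c + u * cnj v * cnj c"
  unfolding qform_def cmod_power2
  by (simp add: complex_eq_iff algebra_simps power2_eq_square)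

lemma qform_nonneg_diag:
  assumes "\<And>u v. 0 \<le> qform a b c u v"
  shows "0 \<le> a" "0 \<le> b"
  using assms[of 1 0] assms[of 0 1] by (auto simp: qform_def)

text \<open>At \<open>(b, - cnj c)\<close> the form is \<open>b\<close> times the determinant. If
  \<open>b = 0\<close>, it is affine in the real number \<open>s\<close> along
  \<open>(1, - s * cnj c)\<close> and stays nonnegative for all \<open>s\<close> only if
  \<open>c = 0\<close>.\<close>

lemma qform_nonneg_det:
  assumes "\<And>u v. 0 \<le> qform a b c u v"
  shows "(cmod c)\<^sup>2 \<le> a * b"
proof (cases "b = 0")
  case True
  have "0 \<le> qform a b c 1 (- of_real s * cnj c)" for s
    by (rule assms)
  then have "2 * s * (cmod c)\<^sup>2 \<le> a" for s
    using True unfolding qform_def cmod_power2 by (simp add: power2_eq_square algebra_simps)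
  \<comment> \<open>Unless \<open>c = 0\<close>, this \<open>s\<close> turns the left side into
    \<open>a + 1\<close>.\<close>
  from this[of "(a + 1) / (2 * (cmod c)\<^sup>2)"] have "c = 0"
    by (cases "c = 0") simp_all
  then show ?thesis using True by simp
next
  case False
  then have b: "b > 0" using qform_nonneg_diag(2)[OF assms] by simp
  have "0 \<le> qform a b c (of_real b) (- cnj c)"
    by (rule assms)
  also have "\<dots> = b * (a * b - (cmod c)\<^sup>2)"
    unfolding qform_def cmod_power2 by (simp add: power2_eq_square algebra_simps)
  finally show ?thesis using b by (simp add: zero_le_mult_iff)
qed

text \<open>\<open>(u, v)\<close> and \<open>(- cnj v, cnj u)\<close> form an orthonormal basis, and
  the invariance of the trace fixes the second diagonal entry.\<close>

lemma qform_rotate: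
  assumes "(cmod u)\<^sup>2 + (cmod v)\<^sup>2 = 1"
  shows "qform a b c (s * u - t * cnj v) (s * v + t * cnj u)
       = qform (qform a b c u v) (a + b - qform a b c u v) (offdiag a b c u v) s t"
proof -
  have n: "u * cnj u + v * cnj v = 1"
    using assms by (metis complex_norm_square of_real_1 of_real_add)
  define q where "q = complex_of_real (qform a b c u v)"
  \<comment> \<open>Multiplying the trace by \<open>u * cnj u + v * cnj v\<close>, which is one,
    makes both sides homogeneous of the same degree, so that the claim becomes a polynomial
    identity.\<close>
  have q: "of_real (a + b - qform a b c u v) = of_real (a + b) * (u * cnj u + v * cnj v) - q"
    by (simp add: n q_def)
  have "complex_of_real (qform a b c (s * u - t * cnj v) (s * v + t * cnj u))
      = complex_of_real (qform (qform a b c u v) (a + b - qform a b c u v) (offdiag a b c u v) s t)"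
    unfolding of_real_qform[of "qform a b c u v"] q q_def unfolding of_real_qform
    by (simp add: offdiag_def algebra_simps)
  then show ?thesis by (simp only: of_real_eq_iff)
qed

lemma norm_rotate:
  assumes "(cmod u)\<^sup>2 + (cmod v)\<^sup>2 = 1"
  shows "(cmod (s * u - t * cnj v))\<^sup>2 + (cmod (s * v + t * cnj u))\<^sup>2 = (cmod s)\<^sup>2 + (cmod t)\<^sup>2"
proof -
  have "qform 1 1 0 u v = 1" "offdiag 1 1 0 u v = 0"
    using assms by (simp_all add: qform_def offdiag_def)
  then show ?thesis using qform_rotate[OF assms, of 1 1 0 s t] by (simp add: qform_def)
qed

text \<open>Spectral decomposition: \<open>l\<close> is the smaller eigenvalue. Subtracting it
  leaves a positive matrix of determinant zero, hence of rank at most one, and \<open>w\<close> is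
  read off from its first row unless that row vanishes.\<close>

lemma rank_one_shift:
  obtains l w0 w1 where
    "\<And>u v. qform a b c u v = l * ((cmod u)\<^sup>2 + (cmod v)\<^sup>2) + (cmod (cnj w0 * u + cnj w1 * v))\<^sup>2"
    "a + b = 2 * l + (cmod w0)\<^sup>2 + (cmod w1)\<^sup>2"
proof -
  define d where "d = sqrt (((a - b) / 2)\<^sup>2 + (cmod c)\<^sup>2)"
  define l where "l = (a + b) / 2 - d"
  have d: "d \<ge> 0" "d\<^sup>2 = ((a - b) / 2)\<^sup>2 + (cmod c)\<^sup>2" by (simp_all add: d_def)
  have "\<bar>(a - b) / 2\<bar> \<le> d" unfolding d_def by (rule real_le_rsqrt) (simp add: power_divide)
  then have nn: "0 \<le> a - l" "0 \<le> b - l" by (simp_all add: l_def field_simps abs_le_iff)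
  have det: "(a - l) * (b - l) = (cmod c)\<^sup>2"
    using d(2) by (simp add: l_def power2_eq_square field_simps)
  show ?thesis
  proof (cases "a - l = 0")
    case True
    then have "c = 0" using det by simp
    show ?thesis
    proof (rule that[of l 0 "of_real (sqrt (b - l))"])
      show "qform a b c u v = l * ((cmod u)\<^sup>2 + (cmod v)\<^sup>2)
          + (cmod (cnj 0 * u + cnj (of_real (sqrt (b - l))) * v))\<^sup>2" for u v
        using True \<open>c = 0\<close> nn by (simp add: qform_def norm_mult power_mult_distrib algebra_simps)
      show "a + b = 2 * l + (cmod 0)\<^sup>2 + (cmod (of_real (sqrt (b - l))))\<^sup>2"
        using True nn by simp
    qed
  next
    case False
    define r where "r = sqrt (a - l)"
    have r: "r > 0" "r\<^sup>2 = a - l" using False nn by (auto simp: r_def)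
    have "r\<^sup>2 * (b - l) = (cmod c)\<^sup>2" using det r(2) by simp
    then have b: "b - l = (cmod c)\<^sup>2 / r\<^sup>2" using r(1) by (simp add: eq_divide_eq mult.commute)
    show ?thesis
    proof (rule that[of l "of_real r" "cnj c / of_real r"])
      show "qform a b c u v = l * ((cmod u)\<^sup>2 + (cmod v)\<^sup>2)
          + (cmod (cnj (of_real r) * u + cnj (cnj c / of_real r) * v))\<^sup>2" for u v
      proof -
        have "(cmod (cnj (of_real r) * u + cnj (cnj c / of_real r) * v))\<^sup>2
          = r\<^sup>2 * (cmod u)\<^sup>2 + (cmod c)\<^sup>2 / r\<^sup>2 * (cmod v)\<^sup>2 + 2 * Re (cnj u * v * c)"
          using r(1) unfolding cmod_power2 by (simp add: field_simps power2_eq_square)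
        also have "\<dots> = (a - l) * (cmod u)\<^sup>2 + (b - l) * (cmod v)\<^sup>2 + 2 * Re (cnj u * v * c)"
          using r b by simp
        finally show ?thesis by (simp add: qform_def algebra_simps)
      qed
      show "a + b = 2 * l + (cmod (of_real r))\<^sup>2 + (cmod (cnj c / of_real r))\<^sup>2"
        using r b by (simp add: norm_divide power_divide)
    qed
  qed
qed

text \<open>A difference of roots times their sum is \<open>m * (x - y)\<close> on the left and
  \<open>x - y\<close> on the right, and \<open>m * sqrt z \<le> sqrt (l + m * z)\<close> since
  \<open>m * m \<le> m\<close>, so the left sum is at least \<open>m\<close> times the right
  one.\<close>

lemma sqrt_affine_diff_le:
  fixes l m x y :: real
  assumes "0 \<le> l" "0 \<le> m" "m \<le> 1" "0 \<le> x" "0 \<le> y"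
  shows "\<bar>sqrt (l + m * x) - sqrt (l + m * y)\<bar> \<le> \<bar>sqrt x - sqrt y\<bar>"
proof -
  have *: "sqrt (l + m * x) - sqrt (l + m * y) \<le> sqrt x - sqrt y" if "0 \<le> y" "y \<le> x" for x y
  proof (cases "x = y")
    case False
    have ge: "m * sqrt z \<le> sqrt (l + m * z)" if "0 \<le> z" for z
    proof (rule real_le_rsqrt)
      have "m * m * z \<le> 1 * m * z" using assms that by (intro mult_right_mono) auto
      then show "(m * sqrt z)\<^sup>2 \<le> l + m * z" using assms that
        by (simp add: power_mult_distrib power2_eq_square[of m])
    qed
    have pos: "0 < sqrt x + sqrt y" using that False by (simp add: add_pos_nonneg)
    have mono: "sqrt (l + m * y) \<le> sqrt (l + m * x)"
      using that assms by (simp add: mult_left_mono)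
    show ?thesis
    proof (cases "m = 0")
      case True then show ?thesis using that by simp
    next
      case m0: False
      have "(sqrt (l + m * x) - sqrt (l + m * y)) * (m * (sqrt x + sqrt y))
          \<le> (sqrt (l + m * x) - sqrt (l + m * y)) * (sqrt (l + m * x) + sqrt (l + m * y))"
        using mono ge[of x] ge[of y] that by (intro mult_left_mono) (auto simp: algebra_simps)
      also have "\<dots> = m * (x - y)"
        using assms that by (simp add: square_diff_square_factored[symmetric] algebra_simps)
      also have "\<dots> = (sqrt x - sqrt y) * (m * (sqrt x + sqrt y))"
        using that by (simp add: algebra_simps)
      finally show ?thesis using pos m0 assms by (simp add: mult_le_cancel_right)
    qed
  qed simp
  have mono: "sqrt (l + m * y) \<le> sqrt (l + m * x)" if "y \<le> x" for x y
    using that assms by (simp add: mult_left_mono)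
  show ?thesis
  proof (cases "y \<le> x")
    case True
    with *[of y x] mono[of y x] assms show ?thesis by simp
  next
    case False
    with *[of x y] mono[of x y] assms show ?thesis by simp
  qed
qed

section \<open>The maximising vector\<close>

text \<open>The first basis vector maximises the difference of roots among unit vectors, so the
  derivative in every direction \<open>(0, z)\<close> vanishes. Positivity of \<open>x\<close> and
  \<open>y\<close> makes the roots differentiable there.\<close>

lemma stationary_point:
  assumes x: "0 < x" and y: "0 < y"
    and max: "\<And>s t. sqrt (qform x (1 - x) \<alpha> s t) - sqrt (qform y (1 - y) \<beta> s t)
        \<le> (sqrt x - sqrt y) * sqrt ((cmod s)\<^sup>2 + (cmod t)\<^sup>2)"
  shows "\<alpha> / of_real (sqrt x) = \<beta> / of_real (sqrt y)"
proof -
  have key: "Re (z * \<alpha>) / sqrt x = Re (z * \<beta>) / sqrt y" if z: "cmod z = 1" for z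
  proof -
    define \<phi> where "\<phi> t = sqrt (x + (1 - x) * t\<^sup>2 + 2 * t * Re (z * \<alpha>))
      - sqrt (y + (1 - y) * t\<^sup>2 + 2 * t * Re (z * \<beta>)) - (sqrt x - sqrt y) * sqrt (1 + t\<^sup>2)" for t
    have q: "qform a (1 - a) c 1 (of_real t * z) = a + (1 - a) * t\<^sup>2 + 2 * t * Re (z * c)" for a c t
      using z by (simp add: qform_def norm_mult power_mult_distrib algebra_simps)
    have le: "\<phi> t \<le> \<phi> 0" for t
    proof -
      have "(cmod 1)\<^sup>2 + (cmod (of_real t * z))\<^sup>2 = 1 + t\<^sup>2"
        using z by (simp add: norm_mult power_mult_distrib)
      then have "\<phi> t \<le> 0" using max[of 1 "of_real t * z"] by (simp add: q \<phi>_def)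
      moreover have "\<phi> 0 = 0" by (simp add: \<phi>_def)
      ultimately show ?thesis by simp
    qed
    have "(\<phi> has_real_derivative Re (z * \<alpha>) / sqrt x - Re (z * \<beta>) / sqrt y) (at 0)"
      unfolding \<phi>_def using x y
      by (auto intro!: derivative_eq_intros simp: field_simps)
    from DERIV_local_max[OF this, of 1] le show ?thesis by simp
  qed
  show ?thesis
    \<comment> \<open>The directions \<open>1\<close> and \<open>\<i>\<close> give the real and
      imaginary parts.\<close>
    using key[of 1] key[of \<i>] x y
    by (simp add: complex_eq_iff Re_divide_of_real Im_divide_of_real)
qed

text \<open>Here \<open>p = sqrt x\<close>, \<open>q = sqrt y\<close> and \<open>k\<close> is the
  squared modulus of \<open>\<kappa>\<close>; \<open>P\<close> and \<open>Q\<close> are the values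
  of the two forms at the test vector \<open>(\<kappa>, - (p + q))\<close>, whose squared norm is
  \<open>N\<close>.\<close>

lemma reflection_bound:
  fixes p q k P Q :: real
  assumes "0 \<le> q" "q < p" "0 \<le> k" "0 \<le> P" "0 \<le> Q"
    and P: "P = (p + q)\<^sup>2 * (1 - p\<^sup>2) - k * p\<^sup>2 - 2 * p * q * k"
    and Q: "Q = (p + q)\<^sup>2 * (1 - q\<^sup>2) - k * q\<^sup>2 - 2 * p * q * k"
    and le: "sqrt Q - sqrt P \<le> (p - q) * sqrt ((p + q)\<^sup>2 + k)"
  shows "p\<^sup>2 + q\<^sup>2 + k \<le> 1"
proof -
  define N where "N = (p + q)\<^sup>2 + k"
  have N: "0 < N" using assms by (simp add: N_def add_pos_nonneg)
  define d where "d = sqrt Q - sqrt P"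
  define s where "s = sqrt Q + sqrt P"
  define d' where "d' = (p - q) * sqrt N"
  define s' where "s' = (p + q) * sqrt N"
  \<comment> \<open>The test vector reverses the sign of the difference of the two forms, up to the
    factor \<open>N\<close>. Thus the roots at the test vector and the scaled roots at the maximiser
    have the same product of sum and difference.\<close>
  have ds: "d * s = d' * s'"
  proof -
    have "d * s = Q - P" using assms by (simp add: d_def s_def algebra_simps)
    also have "\<dots> = (p - q) * (p + q) * N"
      unfolding P Q N_def by (simp add: power2_eq_square algebra_simps)
    also have "\<dots> = d' * s'" using N by (simp add: d'_def s'_def)
    finally show ?thesis .
  qed
  have d': "0 < d'" "d' \<le> s'" "d \<le> d'"
    using assms N le by (simp_all add: d'_def s'_def d_def N_def)
  have s0: "0 \<le> s" using assms by (simp add: s_def)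
  have "0 < d * s" using ds d' by simp
  then have d0: "0 < d" and s1: "0 < s" using s0 by (auto simp: zero_less_mult_iff)
  have "d * s' \<le> d * s"
    unfolding ds using d' by (intro mult_right_mono) auto
  then have ss: "s' \<le> s" using d0 by simp
  \<comment> \<open>With the product \<open>d * s\<close> fixed, the sum of squares grows with
    \<open>s\<close> once \<open>s\<close> exceeds \<open>s'\<close> and \<open>d'\<close>; this
    product of two nonnegative factors expresses that.\<close>
  have "0 \<le> (s\<^sup>2 - s'\<^sup>2) * (s\<^sup>2 - d'\<^sup>2)"
    using ss d' by (intro mult_nonneg_nonneg) (auto intro!: power_mono)
  also have "\<dots> = s\<^sup>2 * (s\<^sup>2 - s'\<^sup>2 - d'\<^sup>2) + (d' * s')\<^sup>2"
    by (simp add: power2_eq_square algebra_simps)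
  also have "\<dots> = s\<^sup>2 * (s\<^sup>2 + d\<^sup>2 - s'\<^sup>2 - d'\<^sup>2)"
    unfolding ds[symmetric] by (simp add: power2_eq_square algebra_simps)
  finally have "s'\<^sup>2 + d'\<^sup>2 \<le> s\<^sup>2 + d\<^sup>2" using s1 by (simp add: zero_le_mult_iff)
  also have "s\<^sup>2 + d\<^sup>2 = 2 * (P + Q)"
    using assms by (simp add: s_def d_def power2_eq_square algebra_simps)
  also have "s'\<^sup>2 + d'\<^sup>2 = N * (2 * p\<^sup>2 + 2 * q\<^sup>2)"
    using N by (simp add: s'_def d'_def power_mult_distrib)
      (simp add: power2_eq_square algebra_simps)
  finally have "0 \<le> 4 * (p + q)\<^sup>2 * (1 - p\<^sup>2 - q\<^sup>2 - k)"
    unfolding P Q N_def by (simp add: power2_eq_square algebra_simps)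
  moreover have "0 < (p + q)\<^sup>2" using assms by simp
  ultimately show ?thesis by (simp add: zero_le_mult_iff)
qed

text \<open>For \<open>y > 0\<close> stationarity yields \<open>\<kappa>\<close> and the reflected
  vector yields the bound. At \<open>y = 0\<close>, where the root need not be differentiable, the
  two determinant conditions give both.\<close>

lemma optimality_conditions:
  assumes A: "\<And>s t. 0 \<le> qform x (1 - x) \<alpha> s t" and B: "\<And>s t. 0 \<le> qform y (1 - y) \<beta> s t"
    and xy: "y < x"
    and max: "\<And>s t. \<bar>sqrt (qform x (1 - x) \<alpha> s t) - sqrt (qform y (1 - y) \<beta> s t)\<bar>
        \<le> (sqrt x - sqrt y) * sqrt ((cmod s)\<^sup>2 + (cmod t)\<^sup>2)"
  obtains \<kappa> where "\<alpha> = of_real (sqrt x) * \<kappa>" "\<beta> = of_real (sqrt y) * \<kappa>" "x + y + (cmod \<kappa>)\<^sup>2 \<le> 1"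
proof -
  have y0: "0 \<le> y" using qform_nonneg_diag[OF B] by simp
  then have x0: "0 < x" using xy by simp
  define \<kappa> where "\<kappa> = \<alpha> / of_real (sqrt x)"
  have \<alpha>: "\<alpha> = of_real (sqrt x) * \<kappa>" using x0 by (simp add: \<kappa>_def)
  show ?thesis
  proof (cases "y = 0")
    case True
    have "\<beta> = 0" using qform_nonneg_det[OF B] True by simp
    have "x * (cmod \<kappa>)\<^sup>2 \<le> x * (1 - x)"
      using qform_nonneg_det[OF A] x0 unfolding \<alpha> by (simp add: norm_mult power_mult_distrib)
    then show ?thesis using that[of \<kappa>] \<alpha> \<open>\<beta> = 0\<close> True x0 by simp
  next
    case False
    then have y: "0 < y" using y0 by simp
    have \<beta>: "\<beta> = of_real (sqrt y) * \<kappa>"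
      using stationary_point[OF x0 y, of \<alpha> \<beta>] max y unfolding \<kappa>_def
      by (simp add: abs_le_iff)
    define p where "p = sqrt x"
    define q where "q = sqrt y"
    define k where "k = (cmod \<kappa>)\<^sup>2"
    have pq: "0 < q" "q < p" "x = p\<^sup>2" "y = q\<^sup>2" using x0 y xy by (auto simp: p_def q_def)
    define P where "P = (p + q)\<^sup>2 * (1 - p\<^sup>2) - k * p\<^sup>2 - 2 * p * q * k"
    define Q where "Q = (p + q)\<^sup>2 * (1 - q\<^sup>2) - k * q\<^sup>2 - 2 * p * q * k"
    \<comment> \<open>Up to a factor, the test vector is the difference of the two matrices applied to
      the second basis vector; it realises the reflection of the Bloch vector of the first basis
      vector along the difference of the Bloch vectors of the two matrices.\<close>
    have qP: "qform x (1 - x) \<alpha> \<kappa> (- of_real (p + q)) = P"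
      unfolding qform_def P_def \<alpha> p_def[symmetric] pq(3) k_def cmod_power2
      using pq(1,2) by (simp add: power2_eq_square algebra_simps)
    have qQ: "qform y (1 - y) \<beta> \<kappa> (- of_real (p + q)) = Q"
      unfolding qform_def Q_def \<beta> q_def[symmetric] pq(4) k_def cmod_power2
      using pq(1,2) by (simp add: power2_eq_square algebra_simps)
    have nn: "(cmod \<kappa>)\<^sup>2 + (cmod (- of_real (p + q)))\<^sup>2 = (p + q)\<^sup>2 + k"
      by (simp only: k_def norm_minus_cancel norm_of_real power2_abs add.commute)
    have "sqrt Q - sqrt P \<le> (p - q) * sqrt ((p + q)\<^sup>2 + k)"
      using max[of \<kappa> "- of_real (p + q)"] unfolding qP qQ nn p_def[symmetric] q_def[symmetric]
      by (simp add: abs_le_iff)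
    moreover have "0 \<le> P" "0 \<le> Q"
      using A[of \<kappa> "- of_real (p + q)"] B[of \<kappa> "- of_real (p + q)"] unfolding qP qQ by simp_all
    ultimately have "p\<^sup>2 + q\<^sup>2 + k \<le> 1"
      using reflection_bound[of q p k P Q] pq by (simp add: P_def Q_def k_def)
    then show ?thesis using that[of \<kappa>] \<alpha> \<beta> pq by (simp add: k_def)
  qed
qed

text \<open>A maximiser exists because the unit sphere is compact; rotating it to the first basis
  vector reduces the claim to the previous lemma, with the states exchanged if
  \<open>x < y\<close>.\<close>

lemma optimality_conditions_exist:
  assumes A: "\<And>s t. 0 \<le> qform a (1 - a) c s t" and B: "\<And>s t. 0 \<le> qform b (1 - b) d s t"
  obtains u v \<kappa> where "(cmod u)\<^sup>2 + (cmod v)\<^sup>2 = 1"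
    "offdiag a (1 - a) c u v = of_real (sqrt (qform a (1 - a) c u v)) * \<kappa>"
    "offdiag b (1 - b) d u v = of_real (sqrt (qform b (1 - b) d u v)) * \<kappa>"
    "qform a (1 - a) c u v + qform b (1 - b) d u v + (cmod \<kappa>)\<^sup>2 \<le> 1"
proof -
  define f where "f w = \<bar>sqrt (qform a (1 - a) c (fst w) (snd w)) - sqrt (qform b (1 - b) d (fst w) (snd w))\<bar>"
    for w :: "complex \<times> complex"
  have cont: "continuous_on S f" for S
    unfolding f_def qform_def by (intro continuous_intros)
  have "\<exists>w\<in>sphere 0 1. \<forall>z\<in>sphere 0 1. f z \<le> f w"
  proof (rule continuous_attains_sup[OF _ _ cont])
    have "((1, 0) :: complex \<times> complex) \<in> sphere 0 1" by (simp add: norm_Pair)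
    then show "sphere (0 :: complex \<times> complex) 1 \<noteq> {}" by blast
  qed simp
  then obtain u v where w: "norm (u, v) = 1" and sup: "\<And>z. norm z = 1 \<Longrightarrow> f z \<le> f (u, v)"
    by fastforce
  have uv: "(cmod u)\<^sup>2 + (cmod v)\<^sup>2 = 1"
    using w by (simp add: norm_Pair)
  have qscale: "qform a b c (of_real r * s) (of_real r * t) = r\<^sup>2 * qform a b c s t" for a b c r s t
    unfolding qform_def cmod_power2 by (simp add: power2_eq_square algebra_simps)
  have f_scale: "f (of_real r * s, of_real r * t) = \<bar>r\<bar> * f (s, t)" for r s t
    by (simp add: f_def qscale real_sqrt_mult abs_mult flip: right_diff_distrib)
  \<comment> \<open>Homogeneity of degree one carries the bound from the sphere to all
    vectors.\<close>
  have max: "f (s, t) \<le> f (u, v) * sqrt ((cmod s)\<^sup>2 + (cmod t)\<^sup>2)" for s t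
  proof (cases "(s, t) = 0")
    case True
    then show ?thesis by (simp add: f_def qform_def zero_prod_def)
  next
    case False
    define r where "r = norm (s, t)"
    have r: "r > 0" using False unfolding r_def zero_less_norm_iff .
    have "norm (of_real (1 / r) * s, of_real (1 / r) * t) = (1 / r) * r"
    proof -
      have "(of_real (1 / r) * s, of_real (1 / r) * t) = (1 / r) *\<^sub>R (s, t)"
        by (simp add: scaleR_conv_of_real)
      then show ?thesis using r by (simp only: norm_scaleR r_def) simp
    qed
    then have "f (of_real (1 / r) * s, of_real (1 / r) * t) \<le> f (u, v)"
      using r by (intro sup) simp
    then have "1 / r * f (s, t) \<le> f (u, v)" using r unfolding f_scale by simp
    then show ?thesis using r by (simp add: r_def norm_Pair field_simps)
  qed
  define x y where "x = qform a (1 - a) c u v" and "y = qform b (1 - b) d u v"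
  define \<alpha> \<beta> where "\<alpha> = offdiag a (1 - a) c u v" and "\<beta> = offdiag b (1 - b) d u v"
  have rotA: "qform a (1 - a) c (s * u - t * cnj v) (s * v + t * cnj u) = qform x (1 - x) \<alpha> s t" for s t
    using qform_rotate[OF uv, of a "1 - a" c s t] by (simp add: x_def \<alpha>_def)
  have rotB: "qform b (1 - b) d (s * u - t * cnj v) (s * v + t * cnj u) = qform y (1 - y) \<beta> s t" for s t
    using qform_rotate[OF uv, of b "1 - b" d s t] by (simp add: y_def \<beta>_def)
  have A': "0 \<le> qform x (1 - x) \<alpha> s t" and B': "0 \<le> qform y (1 - y) \<beta> s t" for s t
    using A B by (simp_all flip: rotA rotB)
  have max': "\<bar>sqrt (qform x (1 - x) \<alpha> s t) - sqrt (qform y (1 - y) \<beta> s t)\<bar>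
        \<le> \<bar>sqrt x - sqrt y\<bar> * sqrt ((cmod s)\<^sup>2 + (cmod t)\<^sup>2)" for s t
    using max[of "s * u - t * cnj v" "s * v + t * cnj u"]
    unfolding norm_rotate[OF uv] f_def fst_conv snd_conv rotA rotB
    by (simp add: x_def y_def)
  consider "y < x" | "x < y" | "x = y" by linarith
  then show ?thesis
  proof cases
    case 1
    then have "\<bar>sqrt x - sqrt y\<bar> = sqrt x - sqrt y" by simp
    from optimality_conditions[OF A' B' 1 max'[unfolded this]] obtain \<kappa>
      where "\<alpha> = of_real (sqrt x) * \<kappa>" "\<beta> = of_real (sqrt y) * \<kappa>" "x + y + (cmod \<kappa>)\<^sup>2 \<le> 1"
      by blast
    then show ?thesis using that[OF uv, of \<kappa>] by (simp add: x_def y_def \<alpha>_def \<beta>_def)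
  next
    case 2
    then have e: "\<bar>sqrt x - sqrt y\<bar> = sqrt y - sqrt x" by simp
    have "\<bar>sqrt (qform y (1 - y) \<beta> s t) - sqrt (qform x (1 - x) \<alpha> s t)\<bar>
        \<le> (sqrt y - sqrt x) * sqrt ((cmod s)\<^sup>2 + (cmod t)\<^sup>2)" for s t
      using max'[of s t] unfolding e by (simp only: abs_minus_commute)
    from optimality_conditions[OF B' A' 2 this] obtain \<kappa>
      where "\<beta> = of_real (sqrt y) * \<kappa>" "\<alpha> = of_real (sqrt x) * \<kappa>" "y + x + (cmod \<kappa>)\<^sup>2 \<le> 1"
      by blast
    then show ?thesis using that[OF uv, of \<kappa>] by (simp add: x_def y_def \<alpha>_def \<beta>_def add.commute)
  next
    case 3
    \<comment> \<open>The maximum is zero, so the two states coincide. An eigenvector for the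
      smaller eigenvalue \<open>l\<close> then works with \<open>\<kappa> = 0\<close>, since trace
      one gives \<open>2 * l \<le> 1\<close>.\<close>
    have "f z \<le> 0" for z
      using max[of "fst z" "snd z"] 3 by (simp add: f_def x_def y_def)
    then have eq: "qform a (1 - a) c s t = qform b (1 - b) d s t" for s t
      using A[of s t] B[of s t] by (simp add: f_def split_paired_all)
    have "a = b" using eq[of 1 0] by (simp add: qform_def)
    moreover have "c = d"
      using eq[of 1 1] eq[of 1 \<i>] \<open>a = b\<close> by (simp add: qform_def complex_eq_iff)
    obtain l w0 w1 where
      w: "\<And>u v. qform a (1 - a) c u v = l * ((cmod u)\<^sup>2 + (cmod v)\<^sup>2) + (cmod (cnj w0 * u + cnj w1 * v))\<^sup>2"
         "a + (1 - a) = 2 * l + (cmod w0)\<^sup>2 + (cmod w1)\<^sup>2"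
      using rank_one_shift[of a "1 - a" c] by metis
    have l: "2 * l \<le> 1" using w(2) by (smt (verit) zero_le_power2)
    obtain u v where uv: "(cmod u)\<^sup>2 + (cmod v)\<^sup>2 = 1" and ker: "cnj w0 * u + cnj w1 * v = 0"
    proof (cases "(w0, w1) = 0")
      case True
      then show ?thesis using that[of 1 0] by (simp add: zero_prod_def)
    next
      case False
      define r where "r = norm (w0, w1)"
      have r: "r > 0" "r\<^sup>2 = (cmod w0)\<^sup>2 + (cmod w1)\<^sup>2"
        using False unfolding r_def zero_less_norm_iff by (simp_all add: norm_Pair)
      have "(cmod (- cnj w1 / of_real r))\<^sup>2 + (cmod (cnj w0 / of_real r))\<^sup>2 = r\<^sup>2 / r\<^sup>2"
        unfolding r(2)[THEN arg_cong, of "\<lambda>x. x / r\<^sup>2"]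
        by (simp add: norm_divide power_divide add_divide_distrib)
      then show ?thesis
        using r(1) by (intro that[of "- cnj w1 / of_real r" "cnj w0 / of_real r"]) simp_all
    qed
    have q: "qform a (1 - a) c u v = l" using w(1)[of u v] uv ker by simp
    have r: "qform l (1 - l) (offdiag a (1 - a) c u v) s t
        \<ge> l * ((cmod s)\<^sup>2 + (cmod t)\<^sup>2)" for s t
      using qform_rotate[OF uv, of a "1 - a" c s t, symmetric] unfolding q
      by (simp add: w(1) norm_rotate[OF uv])
    \<comment> \<open>Subtracting \<open>l\<close> leaves a nonnegative form with a zero diagonal
      entry, which forces the off-diagonal entry to vanish.\<close>
    have "0 \<le> qform 0 (1 - 2 * l) (offdiag a (1 - a) c u v) s t" for s t
      using r[of s t] by (simp add: qform_def algebra_simps)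
    from qform_nonneg_det[OF this] have "offdiag a (1 - a) c u v = 0" by simp
    then show ?thesis
      using that[OF uv, of 0] q l \<open>a = b\<close> \<open>c = d\<close> by simp
  qed
qed

section \<open>Couplings of qubit states\<close>

definition herm2 :: "real \<Rightarrow> real \<Rightarrow> complex \<Rightarrow> complex mat" where
  "herm2 a b c = mat 2 2 (\<lambda>(i, j). if i = 0 then (if j = 0 then of_real a else c)
                                    else (if j = 0 then cnj c else of_real b))"

text \<open>The sesquilinear form \<open>\<langle>xs|A|ys\<rangle>\<close>; lists let explicit
  coordinates unfold by simplification.\<close>

definition expect :: "complex mat \<Rightarrow> complex list \<Rightarrow> complex list \<Rightarrow> complex" where
  "expect A xs ys = (\<Sum>i<length xs. \<Sum>j<length ys. cnj (xs ! i) * A $$ (i, j) * ys ! j)"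

lemma quadratic_form_expect:
  assumes "A \<in> carrier_mat (length xs) (length xs)"
  shows "scalar_prod (conjugate (vec_of_list xs)) (A *\<^sub>v vec_of_list xs) = expect A xs xs"
  using assms
  by (simp add: expect_def scalar_prod_def atLeast0LessThan sum_distrib_left mult.assoc
      vec_of_list_index conjugate_complex_def)

lemma psd_iff_expect:
  "psd n A \<longleftrightarrow> A \<in> carrier_mat n n \<and> (\<forall>i<n. \<forall>j<n. cnj (A $$ (j, i)) = A $$ (i, j)) \<and>
     (\<forall>xs. length xs = n \<longrightarrow> 0 \<le> Re (expect A xs xs))"
proof -
  have adj: "mat_adjoint A = A \<longleftrightarrow> (\<forall>i<n. \<forall>j<n. cnj (A $$ (j, i)) = A $$ (i, j))"
    if "A \<in> carrier_mat n n"
    using that by (auto simp: mat_adjoint_def mat_eq_iff conjugate_complex_def mat_of_rows_def)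
  have quad: "(\<forall>v \<in> carrier_vec n. 0 \<le> Re (scalar_prod (conjugate v) (A *\<^sub>v v)))
      \<longleftrightarrow> (\<forall>xs. length xs = n \<longrightarrow> 0 \<le> Re (expect A xs xs))" if A: "A \<in> carrier_mat n n"
  proof -
    have "(\<forall>v \<in> carrier_vec n. P v) \<longleftrightarrow> (\<forall>xs. length xs = n \<longrightarrow> P (vec_of_list xs))"
      for P :: "complex vec \<Rightarrow> bool"
    proof safe
      fix xs :: "complex list" assume "\<forall>v \<in> carrier_vec (length xs). P v"
      then show "P (vec_of_list xs)" by (metis carrier_vec_dim_vec dim_vec_of_list)
    next
      fix v :: "complex vec" assume "\<forall>xs. length xs = n \<longrightarrow> P (vec_of_list xs)" "v \<in> carrier_vec n"
      then show "P v" by (metis carrier_vecD length_list_of_vec vec_list)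
    qed
    then show ?thesis using A by (auto simp: quadratic_form_expect)
  qed
  show ?thesis unfolding psd_def using adj quad by blast
qed

lemma lessThan_4: "{..<4::nat} = {0, 1, 2, 3}" by auto

lemma lessThan_2: "{..<2::nat} = {0, 1}" by auto

lemma mat_2_eq_iff:
  "mat 2 2 f = mat 2 2 g \<longleftrightarrow> f (0, 0) = g (0, 0) \<and> f (0, 1) = g (0, 1) \<and> f (1, 0) = g (1, 0) \<and> f (1, 1) = g (1, 1)"
  by (auto simp: mat_eq_iff less_2_cases_iff)

lemma dim_herm2 [simp]: "herm2 a b c \<in> carrier_mat 2 2"
  "dim_row (herm2 a b c) = 2" "dim_col (herm2 a b c) = 2"
  by (simp_all add: herm2_def)

lemma expect_herm2: "Re (expect (herm2 a b c) [u, v] [u, v]) = qform a b c u v"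
  unfolding qform_def cmod_power2
  by (simp add: expect_def herm2_def numeral_2_eq_2 power2_eq_square algebra_simps)

lemma psd_2E:
  assumes "psd 2 A"
  obtains a b c where "A = herm2 a b c" "\<And>u v. 0 \<le> qform a b c u v"
proof -
  have dim: "A \<in> carrier_mat 2 2" and herm: "\<And>i j. i < 2 \<Longrightarrow> j < 2 \<Longrightarrow> cnj (A $$ (j, i)) = A $$ (i, j)"
    and pos: "\<And>u v. 0 \<le> Re (expect A [u, v] [u, v])"
    using assms by (auto simp: psd_iff_expect)
  have *: "A $$ (i, i) = of_real (Re (A $$ (i, i)))" if "i < 2" for i
    using herm[OF that that] by (simp add: complex_eq_iff)
  have "A = herm2 (Re (A $$ (0, 0))) (Re (A $$ (1, 1))) (A $$ (0, 1))"
    using dim * herm[of 1 0] by (auto simp: herm2_def mat_eq_iff less_2_cases_iff)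
  then show ?thesis using that pos by (metis expect_herm2)
qed

lemma psd_herm2I:
  assumes "\<And>u v. 0 \<le> qform a b c u v"
  shows "psd 2 (herm2 a b c)"
proof -
  have "0 \<le> Re (expect (herm2 a b c) xs xs)" if len: "length xs = 2" for xs
  proof -
    obtain u v where "xs = [u, v]" using len by (auto simp: length_Suc_conv numeral_2_eq_2)
    then show ?thesis using assms by (simp add: expect_herm2)
  qed
  then show ?thesis by (auto simp: psd_iff_expect herm2_def less_2_cases_iff)
qed

lemma mtrace_herm2: "mtrace (herm2 a b c) = of_real (a + b)"
  by (simp add: mtrace_def herm2_def lessThan_2)

lemma density_2E:
  assumes "density 2 A"
  obtains a c where "A = herm2 a (1 - a) c" "\<And>u v. 0 \<le> qform a (1 - a) c u v"
proof -
  obtain a b c where A: "A = herm2 a b c" "\<And>u v. 0 \<le> qform a b c u v"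
    using assms psd_2E by (metis density_def)
  then have "complex_of_real (a + b) = of_real 1"
    using assms by (simp add: density_def mtrace_herm2)
  then have "b = 1 - a" unfolding of_real_eq_iff by simp
  then show ?thesis using that A by simp
qed

section \<open>Cost and marginals in coordinates, and the lower bound on the cost\<close>

lemma mtrace_cost_Q:
  assumes "R \<in> carrier_mat 4 4"
  shows "mtrace (cost_Q 2 * R) = (R $$ (1, 1) + R $$ (2, 2) - R $$ (1, 2) - R $$ (2, 1)) / 2"
  using assms
  by (simp add: mtrace_def cost_Q_def swap_op_def scalar_prod_def lessThan_4 atLeast0LessThan
      field_simps)

lemma ptrace_B_eq_herm2:
  "ptrace_B 2 R = herm2 a b c \<longleftrightarrow>
     R $$ (0, 0) + R $$ (1, 1) = of_real a \<and> R $$ (2, 2) + R $$ (3, 3) = of_real b \<and>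
     R $$ (0, 2) + R $$ (1, 3) = c \<and> R $$ (2, 0) + R $$ (3, 1) = cnj c"
  by (auto simp: ptrace_B_def herm2_def mat_2_eq_iff lessThan_2 numeral_2_eq_2[symmetric] simp del: One_nat_def)

lemma ptrace_A_eq_herm2:
  "ptrace_A 2 R = herm2 a b c \<longleftrightarrow>
     R $$ (0, 0) + R $$ (2, 2) = of_real a \<and> R $$ (1, 1) + R $$ (3, 3) = of_real b \<and>
     R $$ (0, 1) + R $$ (2, 3) = c \<and> R $$ (1, 0) + R $$ (3, 2) = cnj c"
  by (auto simp: ptrace_A_def herm2_def mat_2_eq_iff lessThan_2 numeral_2_eq_2[symmetric] simp del: One_nat_def)

lemma expect_4:
  "expect A [x0, x1, x2, x3] [y0, y1, y2, y3] =
     cnj x0 * (A $$ (0, 0) * y0 + A $$ (0, 1) * y1 + A $$ (0, 2) * y2 + A $$ (0, 3) * y3)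
   + cnj x1 * (A $$ (1, 0) * y0 + A $$ (1, 1) * y1 + A $$ (1, 2) * y2 + A $$ (1, 3) * y3)
   + cnj x2 * (A $$ (2, 0) * y0 + A $$ (2, 1) * y1 + A $$ (2, 2) * y2 + A $$ (2, 3) * y3)
   + cnj x3 * (A $$ (3, 0) * y0 + A $$ (3, 1) * y1 + A $$ (3, 2) * y2 + A $$ (3, 3) * y3)"
  by (simp add: expect_def lessThan_4 lessThan_Suc numeral_3_eq_3 numeral_2_eq_2 algebra_simps)

text \<open>With \<open>w = (- cnj v, cnj u)\<close> the singlet is
  \<open>|uw\<rangle> - |wu\<rangle>\<close> up to normalisation, so twice the cost is the form of
  \<open>R\<close> at this difference. The determinant condition on the span of the two vectors
  bounds the cross term.\<close>

lemma coupling_cost_ge: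
  assumes R: "R \<in> couplings 2 (herm2 a b c) (herm2 a' b' c')"
    and uv: "(cmod u)\<^sup>2 + (cmod v)\<^sup>2 = 1"
  shows "(sqrt (qform a b c u v) - sqrt (qform a' b' c' u v))\<^sup>2 / 2 \<le> Re (mtrace (cost_Q 2 * R))"
proof -
  have n: "u * cnj u + v * cnj v = 1"
    using uv by (metis complex_norm_square of_real_1 of_real_add)
  have dim: "R \<in> carrier_mat 4 4" and pos: "\<And>xs. length xs = 4 \<Longrightarrow> 0 \<le> Re (expect R xs xs)"
    and pA: "ptrace_B 2 R = herm2 a b c" and pB: "ptrace_A 2 R = herm2 a' b' c'"
    using R by (auto simp: couplings_def density_def psd_iff_expect)
  define uu where "uu = [u * u, u * v, v * u, v * v]"
  define uw where "uw = [- u * cnj v, u * cnj u, - v * cnj v, v * cnj u]"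
  define wu where "wu = [- cnj v * u, - cnj v * v, cnj u * u, cnj u * v]"
  define r where "r = Re (expect R uw uw)"
  define r' where "r' = Re (expect R wu wu)"
  define h where "h = - (expect R uw wu + cnj (expect R wu uw)) / 2"
  have comb: "qform r r' h s t = Re (expect R (map2 (\<lambda>x y. s * x - t * y) uw wu) (map2 (\<lambda>x y. s * x - t * y) uw wu))" for s t
  proof -
    have eq: "expect R (map2 (\<lambda>x y. s * x - t * y) uw wu) (map2 (\<lambda>x y. s * x - t * y) uw wu)
      = cnj s * s * expect R uw uw + cnj t * t * expect R wu wu
        - cnj s * t * expect R uw wu - cnj t * s * expect R wu uw"
      unfolding uw_def wu_def by (simp add: expect_4 algebra_simps)
    show ?thesis
      unfolding eq qform_def cmod_power2
      by (simp add: r_def r'_def h_def power2_eq_square field_simps)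
  qed
  have nn: "0 \<le> r" "0 \<le> r'" "0 \<le> Re (expect R uu uu)"
    unfolding r_def r'_def by (simp_all add: pos uu_def uw_def wu_def)
  have "0 \<le> qform r r' h s t" for s t
    unfolding comb by (rule pos) (simp add: uw_def wu_def)
  from qform_nonneg_det[OF this] have "cmod h \<le> sqrt r * sqrt r'"
    by (simp add: real_le_rsqrt flip: real_sqrt_mult)
  then have h: "- Re h \<le> sqrt r * sqrt r'"
    using abs_Re_le_cmod[of h] by linarith
  have "map2 (\<lambda>x y. 1 * x - 1 * y) uw wu = [0, 1, - 1, 0]"
    using n by (simp add: uw_def wu_def algebra_simps)
  then have cost: "2 * Re (mtrace (cost_Q 2 * R)) = qform r r' h 1 1"
    unfolding comb by (simp add: mtrace_cost_Q[OF dim] expect_4)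
  \<comment> \<open>Summing over the basis \<open>u\<close>, \<open>w\<close> of the second factor
    gives the value of the first marginal at \<open>u\<close>; the leading factor, equal to one,
    balances degrees.\<close>
  have "expect R uu uu + expect R uw uw = (u * cnj u + v * cnj v) *
      ((R $$ (0, 0) + R $$ (1, 1)) * (u * cnj u) + (R $$ (2, 2) + R $$ (3, 3)) * (v * cnj v)
        + cnj u * v * (R $$ (0, 2) + R $$ (1, 3)) + u * cnj v * (R $$ (2, 0) + R $$ (3, 1)))"
    unfolding uu_def uw_def expect_4 by (simp add: algebra_simps)
  also have "\<dots> = of_real (qform a b c u v)"
    unfolding of_real_qform using pA[unfolded ptrace_B_eq_herm2] n by simp
  finally have x: "qform a b c u v = Re (expect R uu uu) + 1 * r"
    unfolding r_def by (metis Re_complex_of_real mult_1 plus_complex.simps(1))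
  have "expect R uu uu + expect R wu wu = (u * cnj u + v * cnj v) *
      ((R $$ (0, 0) + R $$ (2, 2)) * (u * cnj u) + (R $$ (1, 1) + R $$ (3, 3)) * (v * cnj v)
        + cnj u * v * (R $$ (0, 1) + R $$ (2, 3)) + u * cnj v * (R $$ (1, 0) + R $$ (3, 2)))"
    unfolding uu_def wu_def expect_4 by (simp add: algebra_simps)
  also have "\<dots> = of_real (qform a' b' c' u v)"
    unfolding of_real_qform using pB[unfolded ptrace_A_eq_herm2] n by simp
  finally have y: "qform a' b' c' u v = Re (expect R uu uu) + 1 * r'"
    unfolding r'_def by (metis Re_complex_of_real mult_1 plus_complex.simps(1))
  \<comment> \<open>Both marginal values contain the same summand
    \<open>\<langle>uu|R|uu\<rangle>\<close>; dropping this common shift does not decrease the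
    difference of roots (the case \<open>m = 1\<close>).\<close>
  have "(sqrt (qform a b c u v) - sqrt (qform a' b' c' u v))\<^sup>2 \<le> (sqrt r - sqrt r')\<^sup>2"
    unfolding x y abs_le_square_iff[symmetric] using nn by (intro sqrt_affine_diff_le) auto
  also have "\<dots> = r + r' - 2 * (sqrt r * sqrt r')"
    using nn by (simp add: power2_diff)
  also have "\<dots> \<le> r + r' + 2 * Re h"
    using h by linarith
  also have "\<dots> = qform r r' h 1 1"
    by (simp add: qform_def)
  finally show ?thesis using cost by simp
qed

section \<open>Construction of a coupling that attains the bound\<close>

lemma psd_rank_two:
  assumes "0 \<le> e"
  shows "psd n (mat n n (\<lambda>(i, j). x i * cnj (x j) + complex_of_real e * z i * cnj (z j)))" (is "psd n ?A")
proof -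
  have "0 \<le> Re (expect ?A xs xs)" if "length xs = n" for xs
  proof -
    have "expect ?A xs xs = (\<Sum>i<n. cnj (xs ! i) * x i) * cnj (\<Sum>i<n. cnj (xs ! i) * x i)
       + of_real e * ((\<Sum>i<n. cnj (xs ! i) * z i) * cnj (\<Sum>i<n. cnj (xs ! i) * z i))"
      using that unfolding cnj_sum sum_product
      by (simp add: expect_def sum.distrib sum_distrib_left algebra_simps)
    also have "\<dots> = of_real ((cmod (\<Sum>i<n. cnj (xs ! i) * x i))\<^sup>2 + e * (cmod (\<Sum>i<n. cnj (xs ! i) * z i))\<^sup>2)"
      by (simp only: complex_norm_square of_real_add of_real_mult)
    finally show ?thesis using assms by simp
  qed
  then show ?thesis by (auto simp: psd_iff_expect algebra_simps)
qed

text \<open>The inverse change of basis: these are the standard entries of \<open>x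
  |u\<rangle>\<langle>u| + o1 |u\<rangle>\<langle>w| + cnj o1 |w\<rangle>\<langle>u| + (1 - x)
  |w\<rangle>\<langle>w|\<close> with \<open>w = (- cnj v, cnj u)\<close>.\<close>

lemma herm2_from_basis:
  fixes a :: real and c u v x o1 :: complex
  assumes uv: "(cmod u)\<^sup>2 + (cmod v)\<^sup>2 = 1"
  defines "x \<equiv> complex_of_real (qform a (1 - a) c u v)" and "o1 \<equiv> offdiag a (1 - a) c u v"
  shows "x * (u * cnj u) - o1 * u * v - cnj o1 * cnj u * cnj v + (1 - x) * (v * cnj v) = of_real a"
    and "x * (v * cnj v) + o1 * u * v + cnj o1 * cnj u * cnj v + (1 - x) * (u * cnj u) = of_real (1 - a)"
    and "x * (u * cnj v) + o1 * u * u - cnj o1 * cnj v * cnj v - (1 - x) * (u * cnj v) = c"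
    and "x * (cnj u * v) + cnj o1 * cnj u * cnj u - o1 * v * v - (1 - x) * (cnj u * v) = cnj c"
proof -
  define n where "n = u * cnj u + v * cnj v"
  have n: "n = 1"
    using uv unfolding n_def by (metis complex_norm_square of_real_1 of_real_add)
  have x1: "1 - x = of_real a * n + (1 - of_real a) * n - x" by (simp add: n)
  note defs = x_def of_real_qform o1_def offdiag_def n_def
  have "x * (u * cnj u) - o1 * u * v - cnj o1 * cnj u * cnj v + (1 - x) * (v * cnj v) = of_real a * n * n"
    unfolding x1 unfolding defs by (simp add: algebra_simps)
  then show 1: "x * (u * cnj u) - o1 * u * v - cnj o1 * cnj u * cnj v + (1 - x) * (v * cnj v) = of_real a"
    by (simp add: n)
  have "x * (v * cnj v) + o1 * u * v + cnj o1 * cnj u * cnj v + (1 - x) * (u * cnj u)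
      = n - (x * (u * cnj u) - o1 * u * v - cnj o1 * cnj u * cnj v + (1 - x) * (v * cnj v))"
    by (simp add: n_def algebra_simps)
  then show "x * (v * cnj v) + o1 * u * v + cnj o1 * cnj u * cnj v + (1 - x) * (u * cnj u) = of_real (1 - a)"
    by (simp add: n 1)
  have "x * (u * cnj v) + o1 * u * u - cnj o1 * cnj v * cnj v - (1 - x) * (u * cnj v) = c * n * n"
    unfolding x1 unfolding defs by (simp add: algebra_simps)
  then show 3: "x * (u * cnj v) + o1 * u * u - cnj o1 * cnj v * cnj v - (1 - x) * (u * cnj v) = c"
    by (simp add: n)
  show "x * (cnj u * v) + cnj o1 * cnj u * cnj u - o1 * v * v - (1 - x) * (cnj u * v) = cnj c"
    using arg_cong[OF 3, of cnj] by (simp add: x_def)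
qed

lemma coupling_exists:
  fixes a b :: real and c d u v \<kappa> :: complex
  assumes uv: "(cmod u)\<^sup>2 + (cmod v)\<^sup>2 = 1"
    and x0: "0 \<le> qform a (1 - a) c u v" and y0: "0 \<le> qform b (1 - b) d u v"
    and oA: "offdiag a (1 - a) c u v = of_real (sqrt (qform a (1 - a) c u v)) * \<kappa>"
    and oB: "offdiag b (1 - b) d u v = of_real (sqrt (qform b (1 - b) d u v)) * \<kappa>"
    and le: "qform a (1 - a) c u v + qform b (1 - b) d u v + (cmod \<kappa>)\<^sup>2 \<le> 1"
  obtains R where "R \<in> couplings 2 (herm2 a (1 - a) c) (herm2 b (1 - b) d)"
    "Re (mtrace (cost_Q 2 * R)) = (sqrt (qform a (1 - a) c u v) - sqrt (qform b (1 - b) d u v))\<^sup>2 / 2"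
proof -
  define p where "p = complex_of_real (sqrt (qform a (1 - a) c u v))"
  define q where "q = complex_of_real (sqrt (qform b (1 - b) d u v))"
  define e where "e = 1 - qform a (1 - a) c u v - qform b (1 - b) d u v - (cmod \<kappa>)\<^sup>2"
  define n where "n = u * cnj u + v * cnj v"
  define w0 w1 where "w0 = - cnj v" and "w1 = cnj u"
  define xi where "xi = (\<lambda>i. [p * u * w0 + q * w0 * u + cnj \<kappa> * w0 * w0,
      p * u * w1 + q * w0 * v + cnj \<kappa> * w0 * w1,
      p * v * w0 + q * w1 * u + cnj \<kappa> * w1 * w0,
      p * v * w1 + q * w1 * v + cnj \<kappa> * w1 * w1] ! i)"
  define ze where "ze = (\<lambda>i. [w0 * w0, w0 * w1, w1 * w0, w1 * w1] ! i)"
  define R where "R = mat 4 4 (\<lambda>(i, j). xi i * cnj (xi j) + complex_of_real e * ze i * cnj (ze j))"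
  have n: "n = 1"
    using uv unfolding n_def by (metis complex_norm_square of_real_1 of_real_add)
  have real: "cnj p = p" "cnj q = q" by (simp_all add: p_def q_def)
  have pp: "complex_of_real (qform a (1 - a) c u v) = p * p"
    using x0 by (simp add: p_def flip: of_real_mult)
  have qq: "complex_of_real (qform b (1 - b) d u v) = q * q"
    using y0 by (simp add: q_def flip: of_real_mult)
  have ee: "complex_of_real e = 1 - p * p - q * q - \<kappa> * cnj \<kappa>"
    by (simp add: e_def flip: pp qq complex_norm_square)
  have e1: "1 - p * p = \<kappa> * cnj \<kappa> + q * q + of_real e" "1 - q * q = \<kappa> * cnj \<kappa> + p * p + of_real e"
    by (simp_all add: ee)
  note oA = oA[folded p_def] and oB = oB[folded q_def]
  have oA': "cnj (offdiag a (1 - a) c u v) = p * cnj \<kappa>" and oB': "cnj (offdiag b (1 - b) d u v) = q * cnj \<kappa>"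
    by (simp_all add: oA oB real)
  note basisA = herm2_from_basis[OF uv, of a c, unfolded oA oA' pp e1]
  note basisB = herm2_from_basis[OF uv, of b d, unfolded oB oB' qq e1]
  have R: "R $$ (i, j) = xi i * cnj (xi j) + complex_of_real e * ze i * cnj (ze j)" if "i < 4" "j < 4" for i j
    using that by (simp add: R_def)
  have ze: "ze 0 = w0 * w0" "ze 1 = w0 * w1" "ze 2 = w1 * w0" "ze 3 = w1 * w1"
    by (simp_all add: ze_def numeral_3_eq_3 numeral_2_eq_2)
  have ze': "ze 0 = w0 * w0" "ze 2 = w0 * w1" "ze 1 = w1 * w0" "ze 3 = w1 * w1"
    by (simp_all only: ze mult.commute)
  \<comment> \<open>Grouping by the traced factor, \<open>\<xi>\<close> is
    \<open>s \<otimes> w + q w \<otimes> u\<close> and also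
    \<open>w \<otimes> t + p u \<otimes> w\<close>. As \<open>u\<close> and \<open>w\<close> are
    orthonormal, each partial trace is a sum of rank-one terms, which \<open>gram\<close> computes
    entrywise.\<close>
  define s0 s1 where "s0 = p * u + cnj \<kappa> * w0" and "s1 = p * v + cnj \<kappa> * w1"
  define t0 t1 where "t0 = q * u + cnj \<kappa> * w0" and "t1 = q * v + cnj \<kappa> * w1"
  have xiB: "xi 0 = s0 * w0 + q * w0 * u" "xi 1 = s0 * w1 + q * w0 * v"
    "xi 2 = s1 * w0 + q * w1 * u" "xi 3 = s1 * w1 + q * w1 * v"
    by (simp_all add: xi_def s0_def s1_def numeral_3_eq_3 numeral_2_eq_2 algebra_simps)
  have xiA: "xi 0 = t0 * w0 + p * w0 * u" "xi 2 = t0 * w1 + p * w0 * v"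
    "xi 1 = t1 * w0 + p * w1 * u" "xi 3 = t1 * w1 + p * w1 * v"
    by (simp_all add: xi_def t0_def t1_def numeral_3_eq_3 numeral_2_eq_2 algebra_simps)
  have gram: "R $$ (i, j) + R $$ (i', j')
      = z * cnj z' + y * cnj y' + of_real e * (m * cnj m')"
    if "xi i = z * w0 + y * u" "xi i' = z * w1 + y * v" "xi j = z' * w0 + y' * u" "xi j' = z' * w1 + y' * v"
      "ze i = m * w0" "ze i' = m * w1" "ze j = m' * w0" "ze j' = m' * w1"
      "i < 4" "j < 4" "i' < 4" "j' < 4" for i i' j j' z y z' y' m m'
  proof -
    have "R $$ (i, j) + R $$ (i', j') = n * (z * cnj z' + y * cnj y' + of_real e * (m * cnj m'))"
      unfolding R[OF that(9,10)] R[OF that(11,12)] that(1-8) n_def w0_def w1_def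
      by (simp add: algebra_simps)
    then show ?thesis by (simp add: n)
  qed
  have pB: "ptrace_B 2 R = herm2 a (1 - a) c"
  proof -
    have "R $$ (0, 0) + R $$ (1, 1) = s0 * cnj s0 + (q * w0) * cnj (q * w0) + of_real e * (w0 * cnj w0)"
      by (rule gram[OF xiB(1,2) xiB(1,2) ze(1,2) ze(1,2)]) simp_all
    moreover have "R $$ (2, 2) + R $$ (3, 3) = s1 * cnj s1 + (q * w1) * cnj (q * w1) + of_real e * (w1 * cnj w1)"
      by (rule gram[OF xiB(3,4) xiB(3,4) ze(3,4) ze(3,4)]) simp_all
    moreover have "R $$ (0, 2) + R $$ (1, 3) = s0 * cnj s1 + (q * w0) * cnj (q * w1) + of_real e * (w0 * cnj w1)"
      by (rule gram[OF xiB(1,2) xiB(3,4) ze(1,2) ze(3,4)]) simp_all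
    moreover have "R $$ (2, 0) + R $$ (3, 1) = s1 * cnj s0 + (q * w1) * cnj (q * w0) + of_real e * (w1 * cnj w0)"
      by (rule gram[OF xiB(3,4) xiB(1,2) ze(3,4) ze(1,2)]) simp_all
    ultimately show ?thesis
      unfolding ptrace_B_eq_herm2 basisA[symmetric]
      by (simp add: s0_def s1_def w0_def w1_def real algebra_simps)
  qed
  have pA: "ptrace_A 2 R = herm2 b (1 - b) d"
  proof -
    have "R $$ (0, 0) + R $$ (2, 2) = t0 * cnj t0 + (p * w0) * cnj (p * w0) + of_real e * (w0 * cnj w0)"
      by (rule gram[OF xiA(1,2) xiA(1,2) ze'(1,2) ze'(1,2)]) simp_all
    moreover have "R $$ (1, 1) + R $$ (3, 3) = t1 * cnj t1 + (p * w1) * cnj (p * w1) + of_real e * (w1 * cnj w1)"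
      by (rule gram[OF xiA(3,4) xiA(3,4) ze'(3,4) ze'(3,4)]) simp_all
    moreover have "R $$ (0, 1) + R $$ (2, 3) = t0 * cnj t1 + (p * w0) * cnj (p * w1) + of_real e * (w0 * cnj w1)"
      by (rule gram[OF xiA(1,2) xiA(3,4) ze'(1,2) ze'(3,4)]) simp_all
    moreover have "R $$ (1, 0) + R $$ (3, 2) = t1 * cnj t0 + (p * w1) * cnj (p * w0) + of_real e * (w1 * cnj w0)"
      by (rule gram[OF xiA(3,4) xiA(1,2) ze'(3,4) ze'(1,2)]) simp_all
    ultimately show ?thesis
      unfolding ptrace_A_eq_herm2 basisB[symmetric]
      by (simp add: t0_def t1_def w0_def w1_def real algebra_simps)
  qed
  have dim: "R \<in> carrier_mat 4 4" by (simp add: R_def)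
  have "mtrace R = (R $$ (0, 0) + R $$ (1, 1)) + (R $$ (2, 2) + R $$ (3, 3))"
    using dim by (simp add: mtrace_def lessThan_4)
  also have "\<dots> = of_real a + of_real (1 - a)"
    using pB unfolding ptrace_B_eq_herm2 by simp
  finally have "mtrace R = 1" by simp
  moreover have "psd 4 R"
    unfolding R_def using le by (intro psd_rank_two) (simp add: e_def)
  ultimately have "R \<in> couplings 2 (herm2 a (1 - a) c) (herm2 b (1 - b) d)"
    using pA pB by (simp add: couplings_def density_def)
  moreover have "Re (mtrace (cost_Q 2 * R))
      = (sqrt (qform a (1 - a) c u v) - sqrt (qform b (1 - b) d u v))\<^sup>2 / 2"
  proof -
    \<comment> \<open>Only the singlet component contributes to the cost:
      \<open>|ww\<rangle>\<close> is symmetric, and \<open>\<xi>\<close> has antisymmetric part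
      proportional to \<open>p - q\<close>.\<close>
    have "xi 1 - xi 2 = n * (p - q)"
      unfolding xiB n_def s0_def s1_def w0_def w1_def by (simp add: algebra_simps)
    then have "xi 1 - xi 2 = p - q" by (simp add: n)
    have "ze 1 = ze 2" by (simp only: ze mult.commute)
    then have "mtrace (cost_Q 2 * R) = (xi 1 - xi 2) * cnj (xi 1 - xi 2) / 2"
      unfolding mtrace_cost_Q[OF dim] by (simp add: R algebra_simps)
    also have "\<dots> = (p - q) * cnj (p - q) / 2" by (simp only: \<open>xi 1 - xi 2 = p - q\<close>)
    also have "\<dots> = of_real ((sqrt (qform a (1 - a) c u v) - sqrt (qform b (1 - b) d u v))\<^sup>2 / 2)"
      by (simp add: p_def q_def power2_eq_square)
    finally show ?thesis by (simp only: Re_complex_of_real)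
  qed
  ultimately show ?thesis using that by blast
qed

lemma optimal_coupling:
  assumes A: "\<And>s t. 0 \<le> qform a (1 - a) c s t" and B: "\<And>s t. 0 \<le> qform b (1 - b) d s t"
  obtains u v R where "(cmod u)\<^sup>2 + (cmod v)\<^sup>2 = 1"
    "R \<in> couplings 2 (herm2 a (1 - a) c) (herm2 b (1 - b) d)"
    "Re (mtrace (cost_Q 2 * R)) = (sqrt (qform a (1 - a) c u v) - sqrt (qform b (1 - b) d u v))\<^sup>2 / 2"
  by (rule optimality_conditions_exist[OF A B]) (metis coupling_exists A B that)

section \<open>Channels\<close>

text \<open>Positivity of the image is the case \<open>k = 1\<close> of complete positivity.\<close>

lemma CPTP_density:
  assumes \<Phi>: "CPTP 2 \<Phi>" and "density 2 A"
  shows "density 2 (\<Phi> A)"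
proof -
  have A: "A \<in> carrier_mat 2 2" "psd (1 * 2) A" "mtrace A = 1"
    using assms(2) by (simp_all add: density_def psd_def)
  then have "psd (1 * 2) (id_tensor 1 2 \<Phi> A)"
    using \<Phi> unfolding CPTP_def completely_positive_def by blast
  moreover have "id_tensor 1 2 \<Phi> A = \<Phi> A"
  proof -
    have "mat 2 2 (($$) A) = A" using A(1) by auto
    moreover have "\<Phi> A \<in> carrier_mat 2 2"
      using \<Phi> A(1) by (simp add: CPTP_def linear_map_mat_def)
    ultimately show ?thesis by (intro eq_matI) (auto simp: id_tensor_def)
  qed
  ultimately show ?thesis
    using \<Phi> A by (simp add: density_def CPTP_def trace_preserving_def)
qed

lemma expect_2:
  "expect A [x0, x1] [y0, y1] = cnj x0 * (A $$ (0, 0) * y0 + A $$ (0, 1) * y1)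
     + cnj x1 * (A $$ (1, 0) * y0 + A $$ (1, 1) * y1)"
  by (simp add: expect_def numeral_2_eq_2 algebra_simps)

text \<open>Expansion in matrix units; \<open>e\<close>, \<open>f\<close> and \<open>g\<close> are
  entries of the effect obtained by pulling \<open>|u\<rangle>\<langle>u|\<close> back along
  \<open>\<Phi>\<close>.\<close>

lemma linear_map_expect_qform:
  assumes "linear_map_mat 2 \<Phi>"
  obtains e f g where "\<And>a b c. Re (expect (\<Phi> (herm2 a b c)) [u, v] [u, v])
    = a * e + b * f + 2 * Re (c * g)"
proof -
  define E where "E i j = mat 2 2 (\<lambda>p. if p = (i, j) then 1 else 0 :: complex)" for i j :: nat
  define L where "L X = expect (\<Phi> X) [u, v] [u, v]" for X
  have E: "E i j \<in> carrier_mat 2 2" for i j by (simp add: E_def)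
  have lin: "\<And>A B. A \<in> carrier_mat 2 2 \<Longrightarrow> B \<in> carrier_mat 2 2 \<Longrightarrow> L (A + B) = L A + L B"
    "\<And>A k. A \<in> carrier_mat 2 2 \<Longrightarrow> L (k \<cdot>\<^sub>m A) = k * L A"
  proof -
    have c: "\<Phi> A \<in> carrier_mat 2 2" if "A \<in> carrier_mat 2 2" for A
      using assms that by (simp add: linear_map_mat_def)
    fix A B :: "complex mat" and k :: complex
    assume A: "A \<in> carrier_mat 2 2"
    show "L (k \<cdot>\<^sub>m A) = k * L A"
      using assms A carrier_matD[OF c[OF A]]
      by (simp add: L_def linear_map_mat_def expect_2 algebra_simps)
    assume B: "B \<in> carrier_mat 2 2"
    show "L (A + B) = L A + L B"
      using assms A B carrier_matD[OF c[OF A]] carrier_matD[OF c[OF B]]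
      by (simp add: L_def linear_map_mat_def expect_2 algebra_simps)
  qed
  have dec: "herm2 a b c = (of_real a \<cdot>\<^sub>m E 0 0 + of_real b \<cdot>\<^sub>m E 1 1) + (c \<cdot>\<^sub>m E 0 1 + cnj c \<cdot>\<^sub>m E 1 0)" for a b c
    by (auto simp: herm2_def E_def mat_eq_iff less_2_cases_iff)
  have L_herm2: "L (herm2 a b c) = (of_real a * L (E 0 0) + of_real b * L (E 1 1)) + (c * L (E 0 1) + cnj c * L (E 1 0))" for a b c
    unfolding dec by (simp add: lin E)
  have "Re (L (herm2 a b c)) = a * Re (L (E 0 0)) + b * Re (L (E 1 1))
      + 2 * Re (c * ((L (E 0 1) + cnj (L (E 1 0))) / 2))" for a b c
    unfolding L_herm2 by (simp add: field_simps)
  then show ?thesis using that unfolding L_def by blast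
qed


lemma density_herm2I:
  assumes "\<And>u v. 0 \<le> qform a (1 - a) c u v"
  shows "density 2 (herm2 a (1 - a) c)"
  using psd_herm2I[OF assms] by (simp add: density_def mtrace_herm2)

lemma density_expect_bounds:
  assumes "density 2 A" and uv: "(cmod u)\<^sup>2 + (cmod v)\<^sup>2 = 1"
  shows "0 \<le> Re (expect A [u, v] [u, v])" "Re (expect A [u, v] [u, v]) \<le> 1"
proof -
  obtain a c where A: "A = herm2 a (1 - a) c" and pos: "\<And>u v. 0 \<le> qform a (1 - a) c u v"
    using density_2E[OF assms(1)] by blast
  show "0 \<le> Re (expect A [u, v] [u, v])" by (simp add: A expect_herm2 pos)
  \<comment> \<open>The value at the orthogonal unit vector is the complement to one.\<close>
  have "0 \<le> qform a (1 - a) c (0 * u - 1 * cnj v) (0 * v + 1 * cnj u)" by (rule pos)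
  also have "\<dots> = 1 - qform a (1 - a) c u v"
    unfolding qform_rotate[OF uv] by (simp add: qform_def[of _ _ _ 0 1])
  finally show "Re (expect A [u, v] [u, v]) \<le> 1" by (simp add: A expect_herm2)
qed

text \<open>The effect is \<open>l\<close> plus the rank-one matrix of \<open>w\<close>, and
  \<open>w\<close> is \<open>r\<close> times a unit vector \<open>(s, t)\<close>, so
  \<open>m\<close> is the square of \<open>r\<close>. The pure state orthogonal to
  \<open>(s, t)\<close> is sent to \<open>l\<close> and the pure state of \<open>(s, t)\<close> to
  \<open>l + m\<close>; probabilities lie between zero and one, which bounds both.\<close>

lemma CPTP_expect_affine:
  assumes \<Phi>: "CPTP 2 \<Phi>" and uv: "(cmod u)\<^sup>2 + (cmod v)\<^sup>2 = 1"
  obtains l m s t where "0 \<le> l" "0 \<le> m" "m \<le> 1" "(cmod s)\<^sup>2 + (cmod t)\<^sup>2 = 1"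
    "\<And>a c. Re (expect (\<Phi> (herm2 a (1 - a) c)) [u, v] [u, v]) = l + m * qform a (1 - a) c s t"
proof -
  obtain e f g where L: "\<And>a b c. Re (expect (\<Phi> (herm2 a b c)) [u, v] [u, v]) = a * e + b * f + 2 * Re (c * g)"
    using \<Phi> linear_map_expect_qform unfolding CPTP_def by metis
  obtain l w0 w1 where w: "\<And>u v. qform e f (cnj g) u v
      = l * ((cmod u)\<^sup>2 + (cmod v)\<^sup>2) + (cmod (cnj w0 * u + cnj w1 * v))\<^sup>2"
    using rank_one_shift[of e f "cnj g"] by metis
  have e: "e = l + (cmod w0)\<^sup>2" using w[of 1 0] by (simp add: qform_def)
  have f: "f = l + (cmod w1)\<^sup>2" using w[of 0 1] by (simp add: qform_def)
  \<comment> \<open>Polarisation: the vectors \<open>(1, 1)\<close> and \<open>(1, \<i>)\<close>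
    determine the off-diagonal entry.\<close>
  have g: "g = cnj w0 * w1"
    using w[of 1 1] w[of 1 \<i>] unfolding qform_def e f cmod_power2
    by (simp add: complex_eq_iff power2_eq_square algebra_simps)
  have L': "Re (expect (\<Phi> (herm2 a (1 - a) c)) [u, v] [u, v]) = l + qform a (1 - a) c w0 w1" for a c
    unfolding L e f g qform_def by (simp add: algebra_simps)
  have bounds: "0 \<le> l + qform a (1 - a) c w0 w1" "l + qform a (1 - a) c w0 w1 \<le> 1"
    if "\<And>u v. 0 \<le> qform a (1 - a) c u v" for a c
    using density_expect_bounds[OF CPTP_density[OF \<Phi> density_herm2I[OF that]] uv] by (simp_all add: L')
  define r where "r = norm (w0, w1)"
  have r2: "r\<^sup>2 = (cmod w0)\<^sup>2 + (cmod w1)\<^sup>2" by (simp add: r_def norm_Pair)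
  show ?thesis
  proof (cases "r = 0")
    case True
    then have "w0 = 0" "w1 = 0" by (simp_all add: r_def norm_Pair sum_power2_eq_zero_iff)
    moreover have "0 \<le> l"
      using bounds(1)[of 1 0] \<open>w0 = 0\<close> \<open>w1 = 0\<close> by (simp add: qform_def)
    ultimately show ?thesis
      using L' by (intro that[of l 0 1 0]) (simp_all add: qform_def)
  next
    case False
    define s t where "s = w0 / of_real r" and "t = w1 / of_real r"
    have ws: "w0 = of_real r * s" "w1 = of_real r * t" using False by (simp_all add: s_def t_def)
    have "r\<^sup>2 * ((cmod s)\<^sup>2 + (cmod t)\<^sup>2) = r\<^sup>2 * 1"
      using r2 by (simp add: ws norm_mult power_mult_distrib algebra_simps)
    then have st: "(cmod s)\<^sup>2 + (cmod t)\<^sup>2 = 1" using False by simp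
    have scale: "qform a (1 - a) c w0 w1 = r\<^sup>2 * qform a (1 - a) c s t" for a c
      unfolding qform_def ws cmod_power2 by (simp add: power2_eq_square algebra_simps)
    have s2: "1 - (cmod s)\<^sup>2 = (cmod t)\<^sup>2" and t2: "1 - (cmod t)\<^sup>2 = (cmod s)\<^sup>2" using st by simp_all
    have "0 \<le> l"
    proof -
      have "qform ((cmod t)\<^sup>2) (1 - (cmod t)\<^sup>2) (- s * cnj t) u v = (cmod (t * u - s * v))\<^sup>2" for u v
        unfolding t2 unfolding qform_def cmod_power2 by (simp add: power2_eq_square algebra_simps)
      then have "0 \<le> l + r\<^sup>2 * (cmod (t * s - s * t))\<^sup>2"
        using bounds(1)[of "(cmod t)\<^sup>2" "- s * cnj t"] unfolding scale by simp
      then show ?thesis by simp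
    qed
    moreover have "l + r\<^sup>2 \<le> 1"
    proof -
      have q: "qform ((cmod s)\<^sup>2) (1 - (cmod s)\<^sup>2) (s * cnj t) u v = (cmod (cnj s * u + cnj t * v))\<^sup>2" for u v
        unfolding s2 unfolding qform_def cmod_power2 by (simp add: power2_eq_square algebra_simps)
      have "cnj s * s + cnj t * t = of_real 1"
        unfolding st[symmetric] by (simp only: of_real_add complex_norm_square mult.commute)
      then have "cmod (cnj s * s + cnj t * t) = 1" by simp
      then show ?thesis
        using bounds(2)[of "(cmod s)\<^sup>2" "s * cnj t"] unfolding scale by (simp add: q)
    qed
    ultimately show ?thesis
      using st L' by (intro that[of l "r\<^sup>2" s t]) (simp_all add: scale)
  qed
qed

section \<open>Monotonicity of the transport cost\<close>

theorem theorem5p1: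
  fixes \<Phi> :: "complex mat \<Rightarrow> complex mat" and \<rho>A \<rho>B :: "complex mat"
  assumes "CPTP 2 \<Phi>"
    and "density 2 \<rho>A" and "density 2 \<rho>B"
  shows "T_Q 2 (\<Phi> \<rho>A) (\<Phi> \<rho>B) \<le> T_Q 2 \<rho>A \<rho>B"
proof -
  obtain a c where A: "\<rho>A = herm2 a (1 - a) c" "\<And>u v. 0 \<le> qform a (1 - a) c u v"
    using density_2E[OF assms(2)] by blast
  obtain b d where B: "\<rho>B = herm2 b (1 - b) d" "\<And>u v. 0 \<le> qform b (1 - b) d u v"
    using density_2E[OF assms(3)] by blast
  obtain a' c' where A': "\<Phi> \<rho>A = herm2 a' (1 - a') c'" "\<And>u v. 0 \<le> qform a' (1 - a') c' u v"
    using density_2E[OF CPTP_density[OF assms(1,2)]] by blast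
  obtain b' d' where B': "\<Phi> \<rho>B = herm2 b' (1 - b') d'" "\<And>u v. 0 \<le> qform b' (1 - b') d' u v"
    using density_2E[OF CPTP_density[OF assms(1,3)]] by blast
  define cost where "cost R = Re (mtrace (cost_Q 2 * R))" for R
  \<comment> \<open>The direction \<open>(u, v)\<close> is optimal for the output states; pulling it
    back along \<open>\<Phi>\<close> gives the direction \<open>(s, t)\<close> in which the input
    states are compared.\<close>
  obtain u v R' where uv: "(cmod u)\<^sup>2 + (cmod v)\<^sup>2 = 1" and R': "R' \<in> couplings 2 (\<Phi> \<rho>A) (\<Phi> \<rho>B)"
    and cost': "cost R' = (sqrt (qform a' (1 - a') c' u v) - sqrt (qform b' (1 - b') d' u v))\<^sup>2 / 2"
    using optimal_coupling[OF A'(2) B'(2)] unfolding A'(1) B'(1) cost_def by metis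
  \<comment> \<open>Some coupling of the inputs must exist for a lower bound of all costs to lie
    below their infimum.\<close>
  obtain R where R: "R \<in> couplings 2 \<rho>A \<rho>B"
    using optimal_coupling[OF A(2) B(2)] unfolding A(1) B(1) by metis
  obtain l m s t where lm: "0 \<le> l" "0 \<le> m" "m \<le> 1" and st: "(cmod s)\<^sup>2 + (cmod t)\<^sup>2 = 1"
    and aff: "\<And>a c. Re (expect (\<Phi> (herm2 a (1 - a) c)) [u, v] [u, v]) = l + m * qform a (1 - a) c s t"
    using CPTP_expect_affine[OF assms(1) uv] by metis
  have x: "qform a' (1 - a') c' u v = l + m * qform a (1 - a) c s t"
    using aff[of a c] by (simp add: A'(1) expect_herm2 flip: A(1))
  have y: "qform b' (1 - b') d' u v = l + m * qform b (1 - b) d s t"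
    using aff[of b d] by (simp add: B'(1) expect_herm2 flip: B(1))
  have "bdd_below (cost ` couplings 2 (\<Phi> \<rho>A) (\<Phi> \<rho>B))"
  proof (rule bdd_belowI2)
    fix R assume "R \<in> couplings 2 (\<Phi> \<rho>A) (\<Phi> \<rho>B)"
    from coupling_cost_ge[OF this[unfolded A'(1) B'(1)] uv] show "0 \<le> cost R"
      unfolding cost_def by (rule order_trans[rotated]) simp
  qed
  then have "T_Q 2 (\<Phi> \<rho>A) (\<Phi> \<rho>B) \<le> cost R'"
    unfolding T_Q_def cost_def[symmetric] using R' by (intro cInf_lower) auto
  also have "\<dots> \<le> (sqrt (qform a (1 - a) c s t) - sqrt (qform b (1 - b) d s t))\<^sup>2 / 2"
    unfolding cost' x y using sqrt_affine_diff_le[OF lm A(2) B(2)]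
    by (simp add: abs_le_square_iff)
  also have "\<dots> \<le> T_Q 2 \<rho>A \<rho>B"
    unfolding T_Q_def
  proof (rule cInf_greatest)
    show "(\<lambda>R. Re (mtrace (cost_Q 2 * R))) ` couplings 2 \<rho>A \<rho>B \<noteq> {}" using R by blast
  qed (use coupling_cost_ge[OF _ st] A(1) B(1) in blast)
  finally show ?thesis .
qed

end
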